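(* Let $k\ge 10$ be an integer and let $n=2k+3$. Let $G$ be a connected $\{C_3,C_4\}$-free graph of order $n$ with no pendant vertices. Then $q(G)\le q'(n)$, where $q'(n)$ is the largest root of $$x^3-\tfrac12(n+9)x^2+(2n+3)x-2n+6=0.$$ Moreover, equality $q(G)=q'(n)$ holds if and only if $G\cong\theta\big(2,3^{\frac{n-3}{2}}\big)$.
   Context: All graphs are finite, simple, undirected and connected. The order of a graph is its number of vertices. A pendant vertex is a vertex of degree $1$. $C_r$ is the cycle on $r$ vertices. A graph is $\mathcal F$-free if it contains no member of the family $\mathcal F$ as a (not necessarily induced) subgraph. $q(G)$ denotes the signless Laplacian spectral radius of $G$, i.e. the largest eigenvalue of $Q(G)=D(G)+A(G)$, where $A(G)$ is the adjacency matrix and $D(G)$ the diagonal matrix of vertex degrees. For positive integers $l_1,\dots,l_k$ ($k\ge 3$), the theta graph $\theta(l_1,\dots,l_k)$ consists of $k$ internally disjoint paths of lengths (numbers of edges) $l_1,\dots,l_k$, all joining the same two distinct end vertices. The notation $l^{\,r}$ means that the length $l$ is repeated $r$ times; thus $\theta(2,3^{r})$ consists of two distinct vertices joined by one path of length $2$ and $r$ paths of length $3$, all internally disjoint. *)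

theory Defs
  imports
    "Graph_Theory.Graph_Theory"
    "Jordan_Normal_Form.Spectral_Radius"
begin

text \<open>
  A finite simple undirected graph is a \<open>pair_graph\<close>: a finite, loop-free, symmetric digraph whose
  arcs are ordered pairs. An undirected edge is the pair of its two opposite arcs, so the
  out-degree of a vertex is its degree in the undirected graph.
\<close>

definition has_pendant_vertex :: "'a pair_pre_digraph \<Rightarrow> bool" where
  "has_pendant_vertex G \<longleftrightarrow> (\<exists>v \<in> pverts G. out_degree (with_proj G) v = 1)"

text \<open>Containment as a (not necessarily induced) subgraph, up to isomorphism.\<close>

definition contains_subgraph :: "'a pair_pre_digraph \<Rightarrow> 'b pair_pre_digraph \<Rightarrow> bool" where
  "contains_subgraph G F \<longleftrightarrow>
     (\<exists>H :: 'a pair_pre_digraph.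
        subgraph (with_proj H) (with_proj G) \<and> digraph_iso (with_proj H) (with_proj F))"

definition free_of :: "'b pair_pre_digraph set \<Rightarrow> 'a pair_pre_digraph \<Rightarrow> bool" where
  "free_of \<F> G \<longleftrightarrow> (\<forall>F \<in> \<F>. \<not> contains_subgraph G F)"

text \<open>Only meaningful for \<open>r \<ge> 3\<close>.\<close>

definition cycle_graph :: "nat \<Rightarrow> nat pair_pre_digraph" where
  "cycle_graph r =
     \<lparr> pverts = {..<r},
       parcs = {(i, j). i < r \<and> j < r \<and> (j = (i + 1) mod r \<or> i = (j + 1) mod r)} \<rparr>"

text \<open>
  \<open>Inner i j\<close> is the vertex at distance \<open>j\<close> from the left end along the \<open>i\<close>-th path;
  \<open>theta_pos ls i j\<close> extends this to the two ends, \<open>j = 0\<close> and \<open>j = ls ! i\<close>.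
\<close>

datatype theta_vertex = Left_End | Right_End | Inner nat nat

definition theta_pos :: "nat list \<Rightarrow> nat \<Rightarrow> nat \<Rightarrow> theta_vertex" where
  "theta_pos ls i j = (if j = 0 then Left_End else if j = ls ! i then Right_End else Inner i j)"

definition theta_graph :: "nat list \<Rightarrow> theta_vertex pair_pre_digraph" where
  "theta_graph ls =
     (let R = {(theta_pos ls i j, theta_pos ls i (j + 1)) | i j. i < length ls \<and> j < ls ! i}
      in \<lparr> pverts = {Left_End, Right_End} \<union> {Inner i j | i j. i < length ls \<and> 0 < j \<and> j < ls ! i},
           parcs = R \<union> R\<inverse> \<rparr>)"

text \<open>
  Matrices in \<open>Jordan_Normal_Form\<close> are indexed by \<open>0, \<dots>, n - 1\<close>, so a list \<open>vs\<close> of the vertices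
  fixes the order of rows and columns. Reordering conjugates the matrix by a permutation matrix
  and leaves the spectrum unchanged, so \<open>q_index\<close> may use an arbitrary enumeration.
\<close>

definition adjacency_mat :: "'a pair_pre_digraph \<Rightarrow> 'a list \<Rightarrow> real mat" where
  "adjacency_mat G vs =
     mat (length vs) (length vs) (\<lambda>(i, j). if (vs ! i, vs ! j) \<in> parcs G then 1 else 0)"

definition degree_mat :: "'a pair_pre_digraph \<Rightarrow> 'a list \<Rightarrow> real mat" where
  "degree_mat G vs =
     mat (length vs) (length vs)
       (\<lambda>(i, j). if i = j then real (out_degree (with_proj G) (vs ! i)) else 0)"

definition signless_laplacian :: "'a pair_pre_digraph \<Rightarrow> 'a list \<Rightarrow> real mat" where
  "signless_laplacian G vs = degree_mat G vs + adjacency_mat G vs"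

definition vertex_enum :: "'a pair_pre_digraph \<Rightarrow> 'a list" where
  "vertex_enum G = (SOME vs. distinct vs \<and> set vs = pverts G)"

text \<open>The matrix is real symmetric, so all of its complex eigenvalues are real and the maximum over
  the real spectrum is the largest eigenvalue.\<close>

definition q_index :: "'a pair_pre_digraph \<Rightarrow> real" where
  "q_index G = Max (spectrum (signless_laplacian G (vertex_enum G)))"

definition q_prime :: "nat \<Rightarrow> real" where
  "q_prime n =
     Max {x :: real. x ^ 3 - 1/2 * (real n + 9) * x ^ 2 + (2 * real n + 3) * x - 2 * real n + 6 = 0}"

end

theory Submission
  imports Defs
begin

text \<open>
  A positive function \<open>w\<close> with \<open>Q w \<le> c w\<close> bounds the spectrum of the nonnegative matrix \<open>Q\<close> by \<open>c\<close>.
  Girth at least five makes the second neighbourhoods disjoint, so the degrees of the neighbours of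
  any vertex sum to at most \<open>n - 1 = 2 k + 2\<close>, and every degree is at most \<open>k + 1\<close>.
  If all degrees are at most \<open>k\<close>, then \<open>w = deg\<close> gives \<open>q(G) \<le> k + 2 + 2 / k < q'(n)\<close>.
  If some \<open>x\<close> has degree \<open>k + 1\<close>, all counts are tight: the neighbours of \<open>x\<close> have degree two and
  are matched with the \<open>k + 1\<close> remaining vertices, which induce a graph \<open>F\<close> of girth at least five.
  Either \<open>F\<close> is a star, which means \<open>G \<cong> \<theta>(2, 3\<^sup>k)\<close> and has a positive eigenvector for \<open>q'(n)\<close>,
  or all degrees in \<open>F\<close> are at most \<open>k - 1\<close>; then weights that are affine in the \<open>F\<close>-degree
  again give \<open>q(G) \<le> k + 2 + 2 / k\<close>.
\<close>

section \<open>Spectra of real symmetric matrices\<close>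

text \<open>For an eigenvector \<open>v\<close>, the Hermitian form \<open>S\<close> of
  \<open>A\<close> at \<open>v\<close> equals its own conjugate by symmetry, and also equals
  \<open>z\<close> times the nonzero squared norm \<open>N\<close>.\<close>

lemma eigenvalue_symmetric_real:
  fixes A :: "real mat"
  assumes A: "A \<in> carrier_mat n n"
    and sym: "\<And>i j. i < n \<Longrightarrow> j < n \<Longrightarrow> A $$ (i, j) = A $$ (j, i)"
    and ev: "eigenvalue (map_mat complex_of_real A) z"
  shows "z \<in> \<real>"
proof -
  obtain v where "eigenvector (map_mat complex_of_real A) v z"
    using ev by (auto simp: eigenvalue_def)
  then have v: "v \<in> carrier_vec n" "v \<noteq> 0\<^sub>v n"
    and Av: "map_mat complex_of_real A *\<^sub>v v = z \<cdot>\<^sub>v v"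
    using A by (auto simp: eigenvector_def)
  have row: "(\<Sum>j<n. complex_of_real (A $$ (i, j)) * v $ j) = z * v $ i" if "i < n" for i
    using arg_cong[OF Av, of "\<lambda>w. w $ i"] that A v
    by (auto simp: scalar_prod_def atLeast0LessThan)
  define S where "S = (\<Sum>i<n. \<Sum>j<n. cnj (v $ i) * complex_of_real (A $$ (i, j)) * v $ j)"
  define N where "N = (\<Sum>i<n. (cmod (v $ i))\<^sup>2)"
  have "cnj S = (\<Sum>j<n. \<Sum>i<n. v $ i * complex_of_real (A $$ (i, j)) * cnj (v $ j))"
    unfolding S_def by (subst sum.swap) simp
  also have "\<dots> = S"
    unfolding S_def by (intro sum.cong refl) (auto simp: sym)
  finally have "S \<in> \<real>"
    by (simp add: Reals_cnj_iff)
  have "S = (\<Sum>i<n. cnj (v $ i) * (z * v $ i))"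
    unfolding S_def by (intro sum.cong refl) (auto simp: sum_distrib_left mult.assoc row[symmetric])
  also have "\<dots> = z * complex_of_real N"
    unfolding N_def of_real_sum sum_distrib_left
    by (intro sum.cong refl) (metis complex_norm_square mult.commute mult.left_commute)
  finally have S: "S = z * complex_of_real N" .
  have "N \<noteq> 0"
  proof
    assume "N = 0"
    then have "\<forall>i<n. v $ i = 0"
      unfolding N_def by (subst (asm) sum_nonneg_eq_0_iff) auto
    with v show False by (auto intro: eq_vecI)
  qed
  then have "z = S / complex_of_real N"
    by (simp add: S)
  with \<open>S \<in> \<real>\<close> show ?thesis by simp
qed

text \<open>Makes the \<open>Max\<close> in \<open>q_index\<close> the maximum of a nonempty set: a
  complex eigenvalue exists, is real by symmetry, and is therefore a root of the real characteristic
  polynomial.\<close>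

lemma symmetric_spectrum_non_empty:
  fixes A :: "real mat"
  assumes A: "A \<in> carrier_mat n n" and "0 < n"
    and sym: "\<And>i j. i < n \<Longrightarrow> j < n \<Longrightarrow> A $$ (i, j) = A $$ (j, i)"
  shows "spectrum A \<noteq> {}"
proof -
  have B: "map_mat complex_of_real A \<in> carrier_mat n n"
    using A by simp
  obtain z where z: "eigenvalue (map_mat complex_of_real A) z"
    using spectrum_non_empty[OF B \<open>0 < n\<close>] by (auto simp: spectrum_def)
  then obtain r where r: "z = complex_of_real r"
    using eigenvalue_symmetric_real[OF A sym] by (auto elim: Reals_cases)
  have "poly (map_poly complex_of_real (char_poly A)) (complex_of_real r) = 0"
    using z eigenvalue_root_char_poly[OF B] of_real_hom.char_poly_hom[OF A, where 'a = complex]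
    by (simp add: r)
  then have "poly (char_poly A) r = 0"
    by simp
  then show ?thesis
    using eigenvalue_root_char_poly[OF A] by (auto simp: spectrum_def)
qed

section \<open>The signless Laplacian as an operator on vertex functions\<close>

text \<open>The vertex set is a separate argument, so that the subgraph induced on a smaller set can
  keep the same relation \<open>E\<close>.\<close>

definition nbs :: "'a set \<Rightarrow> ('a \<Rightarrow> 'a \<Rightarrow> bool) \<Rightarrow> 'a \<Rightarrow> 'a set" where
  "nbs V E v = {u \<in> V. E v u}"

definition laplace_op :: "'a set \<Rightarrow> ('a \<Rightarrow> 'a \<Rightarrow> bool) \<Rightarrow> ('a \<Rightarrow> real) \<Rightarrow> 'a \<Rightarrow> real" where
  "laplace_op V E f v = real (card (nbs V E v)) * f v + (\<Sum>u\<in>nbs V E v. f u)"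

definition adj :: "'a pair_pre_digraph \<Rightarrow> 'a \<Rightarrow> 'a \<Rightarrow> bool" where
  "adj G u v \<longleftrightarrow> (u, v) \<in> parcs G"

lemma nbs_subset: "nbs V E v \<subseteq> V"
  by (auto simp: nbs_def)

lemma finite_nbs [simp]: "finite V \<Longrightarrow> finite (nbs V E v)"
  by (auto simp: nbs_def)

context pair_graph
begin

lemma out_degree_eq_card_nbs: "out_degree (with_proj G) v = card (nbs (pverts G) (adj G) v)"
proof -
  have "out_arcs (with_proj G) v = Pair v ` nbs (pverts G) (adj G) v"
    by (auto simp: out_arcs_def nbs_def adj_def dest: in_arcsD2)
  then show ?thesis
    by (simp add: out_degree_def card_image inj_on_def)
qed

lemma vertex_enum: "distinct (vertex_enum G)" "set (vertex_enum G) = pverts G"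
proof -
  have "distinct (vertex_enum G) \<and> set (vertex_enum G) = pverts G"
    unfolding vertex_enum_def
    by (rule someI_ex) (use finite_distinct_list[OF pair_finite_verts] in blast)
  then show "distinct (vertex_enum G)" "set (vertex_enum G) = pverts G"
    by auto
qed

lemma length_vertex_enum: "length (vertex_enum G) = card (pverts G)"
  by (metis distinct_card vertex_enum)

lemma bij_vertex_enum: "bij_betw ((!) (vertex_enum G)) {..<card (pverts G)} (pverts G)"
  by (rule bij_betw_nth) (auto simp: vertex_enum length_vertex_enum)

lemma signless_laplacian_carrier:
  "signless_laplacian G (vertex_enum G) \<in> carrier_mat (card (pverts G)) (card (pverts G))"
  by (simp add: signless_laplacian_def degree_mat_def adjacency_mat_def length_vertex_enum)

lemma signless_laplacian_mult:
  assumes i: "i < card (pverts G)"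
  shows "(signless_laplacian G (vertex_enum G) *\<^sub>v
            vec (card (pverts G)) (\<lambda>j. f (vertex_enum G ! j))) $ i =
         laplace_op (pverts G) (adj G) f (vertex_enum G ! i)"
proof -
  let ?n = "card (pverts G)" and ?e = "(!) (vertex_enum G)"
  let ?d = "\<lambda>v. real (card (nbs (pverts G) (adj G) v))"
  have inj: "?e i = ?e j \<longleftrightarrow> i = j" if "j < ?n" for j
    using that i bij_vertex_enum by (auto simp: bij_betw_def inj_on_def)
  have "(signless_laplacian G (vertex_enum G) *\<^sub>v vec ?n (\<lambda>j. f (?e j))) $ i =
      (\<Sum>j<?n. signless_laplacian G (vertex_enum G) $$ (i, j) * f (?e j))"
    using i signless_laplacian_carrier by (auto simp: scalar_prod_def atLeast0LessThan)
  also have "\<dots> = (\<Sum>j<?n. (if ?e i = ?e j then ?d (?e i) * f (?e j) else 0) +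
               (if adj G (?e i) (?e j) then f (?e j) else 0))"
    using i
    by (intro sum.cong refl)
      (auto simp: signless_laplacian_def degree_mat_def adjacency_mat_def length_vertex_enum inj
        adj_def out_degree_eq_card_nbs algebra_simps)
  also have "\<dots> = (\<Sum>u\<in>pverts G. (if ?e i = u then ?d (?e i) * f u else 0) +
               (if adj G (?e i) u then f u else 0))"
    by (rule sum.reindex_bij_betw[OF bij_vertex_enum])
  also have "\<dots> = laplace_op (pverts G) (adj G) f (?e i)"
    using i bij_vertex_enum pair_finite_verts
    by (auto simp: sum.distrib laplace_op_def nbs_def bij_betw_def sum.inter_filter)
  finally show ?thesis .
qed

text \<open>Replaces eigenvectors, whose coordinates depend on the chosen enumeration, by functions
  on the vertices.\<close>

lemma eigenvalue_signless_laplacian_iff: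
  "eigenvalue (signless_laplacian G (vertex_enum G)) c \<longleftrightarrow>
     (\<exists>f. (\<exists>v\<in>pverts G. f v \<noteq> 0) \<and> (\<forall>v\<in>pverts G. laplace_op (pverts G) (adj G) f v = c * f v))"
  (is "?L \<longleftrightarrow> ?R")
proof
  let ?n = "card (pverts G)" and ?e = "(!) (vertex_enum G)"
  let ?A = "signless_laplacian G (vertex_enum G)"
  note A = signless_laplacian_carrier
  have onto: "\<exists>i<?n. v = ?e i" if "v \<in> pverts G" for v
    using that bij_vertex_enum by (auto simp: bij_betw_def)
  show ?R if L: ?L
  proof -
    obtain x where x: "x \<in> carrier_vec ?n" "x \<noteq> 0\<^sub>v ?n" "?A *\<^sub>v x = c \<cdot>\<^sub>v x"
      using L carrier_matD(1)[OF A] unfolding eigenvalue_def eigenvector_def by auto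
    define f where "f = (\<lambda>v. x $ (the_inv_into {..<?n} ?e v))"
    have f: "f (?e i) = x $ i" if "i < ?n" for i
      using that bij_vertex_enum by (auto simp: f_def bij_betw_def the_inv_into_f_f)
    have xf: "x = vec ?n (\<lambda>j. f (?e j))"
      using x(1) by (auto simp: f intro!: eq_vecI)
    have "\<exists>i<?n. x $ i \<noteq> 0"
      using x by (auto intro!: eq_vecI)
    then have "\<exists>v\<in>pverts G. f v \<noteq> 0"
      using f bij_vertex_enum by (metis bij_betwE lessThan_iff)
    moreover have "laplace_op (pverts G) (adj G) f v = c * f v" if v: "v \<in> pverts G" for v
    proof -
      obtain i where i: "i < ?n" "v = ?e i"
        using onto[OF v] by auto
      have "laplace_op (pverts G) (adj G) f v = (?A *\<^sub>v x) $ i"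
        using signless_laplacian_mult[OF i(1), of f] i(2) xf by simp
      then show ?thesis
        using x i f by simp
    qed
    ultimately show ?R by auto
  qed
  show ?L if R: ?R
  proof -
    obtain f v where f: "\<forall>v\<in>pverts G. laplace_op (pverts G) (adj G) f v = c * f v"
      and v: "v \<in> pverts G" "f v \<noteq> 0"
      using R by auto
    let ?x = "vec ?n (\<lambda>j. f (?e j))"
    obtain i where "i < ?n" "v = ?e i"
      using onto[OF v(1)] by auto
    then have "?x \<noteq> 0\<^sub>v ?n"
      using v(2) by (metis index_vec index_zero_vec(1))
    moreover have "?A *\<^sub>v ?x = c \<cdot>\<^sub>v ?x"
    proof (rule eq_vecI)
      fix i assume "i < dim_vec (c \<cdot>\<^sub>v ?x)"
      then have i: "i < ?n" by simp
      then have "?e i \<in> pverts G"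
        using bij_vertex_enum by (auto simp: bij_betw_def)
      then show "(?A *\<^sub>v ?x) $ i = (c \<cdot>\<^sub>v ?x) $ i"
        using signless_laplacian_mult[OF i, of f] f i by simp
    qed (use A in auto)
    ultimately show ?L
      using A unfolding eigenvalue_def eigenvector_def by (auto intro!: exI[of _ ?x])
  qed
qed

lemma adj_sym: "adj G u v \<Longrightarrow> adj G v u"
  by (auto simp: adj_def intro: arcs_symmetric)

section \<open>Bounding and computing the spectral radius by test functions\<close>

lemma q_index_in_spectrum:
  assumes "pverts G \<noteq> {}"
  shows "q_index G \<in> spectrum (signless_laplacian G (vertex_enum G))"
proof -
  have "spectrum (signless_laplacian G (vertex_enum G)) \<noteq> {}"
    using assms pair_finite_verts adj_sym
    by (intro symmetric_spectrum_non_empty[OF signless_laplacian_carrier])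
      (auto simp: card_gt_0_iff signless_laplacian_def degree_mat_def adjacency_mat_def
        length_vertex_enum adj_def)
  then show ?thesis
    unfolding q_index_def
    by (intro Max_in card_finite_spectrum(1)[OF signless_laplacian_carrier])
qed

text \<open>A positive supersolution bounds the whole spectrum: compare an eigenfunction
  with it at a vertex where the ratio of absolute values is largest.\<close>

lemma eigenvalue_le_supersolution:
  assumes pos: "\<And>v. v \<in> pverts G \<Longrightarrow> 0 < w v"
    and super: "\<And>v. v \<in> pverts G \<Longrightarrow> laplace_op (pverts G) (adj G) w v \<le> c * w v"
    and ev: "eigenvalue (signless_laplacian G (vertex_enum G)) r"
  shows "r \<le> c"
proof -
  let ?nb = "nbs (pverts G) (adj G)"
  obtain f v0 where f: "\<And>v. v \<in> pverts G \<Longrightarrow> laplace_op (pverts G) (adj G) f v = r * f v"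
    and v0: "v0 \<in> pverts G" "f v0 \<noteq> 0"
    using ev unfolding eigenvalue_signless_laplacian_iff by blast
  define t where "t = Max ((\<lambda>v. \<bar>f v\<bar> / w v) ` pverts G)"
  have fin: "finite ((\<lambda>v. \<bar>f v\<bar> / w v) ` pverts G)"
    using pair_finite_verts by simp
  have "t \<in> (\<lambda>v. \<bar>f v\<bar> / w v) ` pverts G"
    unfolding t_def using v0 by (intro Max_in fin) auto
  then obtain u where u: "u \<in> pverts G" "t = \<bar>f u\<bar> / w u"
    by auto
  have le: "\<bar>f v\<bar> \<le> t * w v" if "v \<in> pverts G" for v
    using Max_ge[OF fin, of "\<bar>f v\<bar> / w v"] pos[OF that] that
    by (auto simp: t_def[symmetric] divide_le_eq)
  have "0 < t * w v0"
    using le[OF v0(1)] v0(2) by linarith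
  then have "0 < t"
    using pos[OF v0(1)] by (simp add: zero_less_mult_iff)
  have fu: "\<bar>f u\<bar> = t * w u"
    using u pos[OF u(1)] by simp
  have "r * \<bar>f u\<bar> \<le> \<bar>r * f u\<bar>"
    by (simp add: abs_mult mult_right_mono)
  also have "\<dots> \<le> real (card (?nb u)) * \<bar>f u\<bar> + (\<Sum>v\<in>?nb u. \<bar>f v\<bar>)"
    unfolding f[OF u(1), symmetric] laplace_op_def
    by (rule order_trans[OF abs_triangle_ineq]) (auto simp: abs_mult)
  also have "\<dots> \<le> real (card (?nb u)) * (t * w u) + (\<Sum>v\<in>?nb u. t * w v)"
    using le nbs_subset[of "pverts G" "adj G" u] by (intro add_mono sum_mono) (auto simp: fu)
  also have "\<dots> = t * laplace_op (pverts G) (adj G) w u"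
    by (simp add: laplace_op_def algebra_simps sum_distrib_left)
  also have "\<dots> \<le> t * (c * w u)"
    using super[OF u(1)] \<open>0 < t\<close> by (intro mult_left_mono) auto
  finally have "r * (t * w u) \<le> c * (t * w u)"
    by (simp add: fu algebra_simps)
  then show ?thesis
    using \<open>0 < t\<close> pos[OF u(1)] by simp
qed

lemma q_index_le:
  assumes "pverts G \<noteq> {}"
    and "\<And>v. v \<in> pverts G \<Longrightarrow> 0 < w v"
    and "\<And>v. v \<in> pverts G \<Longrightarrow> laplace_op (pverts G) (adj G) w v \<le> c * w v"
  shows "q_index G \<le> c"
  using q_index_in_spectrum[OF assms(1)] eigenvalue_le_supersolution[OF assms(2,3)]
  by (auto simp: spectrum_def)

text \<open>A positive eigenfunction is at once a supersolution, which bounds the spectrum from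
  above, and a witness that \<open>c\<close> is attained.\<close>

lemma q_index_eq:
  assumes ne: "pverts G \<noteq> {}"
    and pos: "\<And>v. v \<in> pverts G \<Longrightarrow> 0 < w v"
    and eq: "\<And>v. v \<in> pverts G \<Longrightarrow> laplace_op (pverts G) (adj G) w v = c * w v"
  shows "q_index G = c"
proof (rule antisym)
  show "q_index G \<le> c"
    using pos eq by (intro q_index_le[OF ne, of w]) auto
  obtain v where "v \<in> pverts G"
    using ne by auto
  then have "\<exists>v\<in>pverts G. w v \<noteq> 0"
    using pos[of v] by (intro bexI[of _ v]) auto
  then have "eigenvalue (signless_laplacian G (vertex_enum G)) c"
    unfolding eigenvalue_signless_laplacian_iff using eq by (intro exI[of _ w] conjI ballI)
  then show "c \<le> q_index G"
    unfolding q_index_def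
    by (intro Max_ge card_finite_spectrum(1)[OF signless_laplacian_carrier])
      (simp add: spectrum_def)
qed

end

section \<open>Graphs of girth at least five\<close>

text \<open>The disjunction in \<open>no_square\<close> admits the degenerate closed walks of length
  four that run back over an edge.\<close>

locale girth5 =
  fixes V :: "'a set" and E :: "'a \<Rightarrow> 'a \<Rightarrow> bool"
  assumes finite_V [simp]: "finite V"
    and E_sym: "E a b \<Longrightarrow> E b a"
    and E_irrefl: "\<not> E a a"
    and no_triangle: "E a b \<Longrightarrow> E b c \<Longrightarrow> \<not> E c a"
    and no_square: "E a b \<Longrightarrow> E b c \<Longrightarrow> E c d \<Longrightarrow> E d a \<Longrightarrow> a = c \<or> b = d"
begin

abbreviation "nb \<equiv> nbs V E"

abbreviation "dg v \<equiv> card (nb v)"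

text \<open>The sum counts the walks of length two from \<open>v\<close>; these are mapped
  injectively into the vertices other than \<open>v\<close>.\<close>

lemma sum_nb_degree_less:
  assumes v: "v \<in> V"
  shows "(\<Sum>u\<in>nb v. dg u) + 1 \<le> card V"
proof -
  let ?S = "SIGMA u:nb v. nb u"
  \<comment> \<open>A walk \<open>v, u, t\<close> is charged to its end \<open>t\<close>, except
    that a walk returning to \<open>v\<close> is charged to its middle vertex
    \<open>u\<close>.\<close>
  let ?h = "\<lambda>(u, t). if t = v then u else t"
  have inj: "inj_on ?h ?S"
  proof (rule inj_onI, clarify)
    fix u t u' t'
    assume h: "t \<in> nb u" "u \<in> nb v" "t' \<in> nb u'" "u' \<in> nb v"
      "(if t = v then u else t) = (if t' = v then u' else t')"
    then have e: "E v u" "E u t" "E v u'" "E u' t'"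
      by (auto simp: nbs_def)
    \<comment> \<open>If exactly one walk returns to \<open>v\<close>, equal charges close a
      triangle; if neither does, distinct middle vertices close a square.\<close>
    show "u = u' \<and> t = t'"
    proof (cases "t = v"; cases "t' = v")
      assume "t = v" "t' \<noteq> v"
      with h(5) have "u = t'" by simp
      with e show ?thesis using no_triangle[of v u' u] E_sym by blast
    next
      assume "t \<noteq> v" "t' = v"
      with h(5) have "u' = t" by simp
      with e show ?thesis using no_triangle[of v u u'] E_sym by blast
    next
      assume "t \<noteq> v" "t' \<noteq> v"
      moreover from this h(5) have "t = t'" by simp
      ultimately show ?thesis
        using no_square[of v u t u'] e E_sym by blast
    qed (use h(5) in simp)
  qed
  have sub: "?h ` ?S \<subseteq> V - {v}"
    using E_irrefl by (auto simp: nbs_def split: if_splits)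
  have "(\<Sum>u\<in>nb v. dg u) = card ?S"
    by (subst card_SigmaI) auto
  also have "\<dots> \<le> card (V - {v})"
    by (rule card_inj_on_le[OF inj sub]) simp
  finally show ?thesis
    using card_Suc_Diff1[OF finite_V v] by linarith
qed

text \<open>Double counting: \<open>dg u\<close> is contributed once for each neighbour of
  \<open>u\<close>, so the squares add up to the neighbour-degree sums of all vertices.\<close>

lemma sum_degree_squares:
  "(\<Sum>v\<in>V. (dg v)\<^sup>2) + card V \<le> (card V)\<^sup>2"
proof -
  have "(\<Sum>v\<in>V. (dg v)\<^sup>2) = (\<Sum>u\<in>V. \<Sum>v\<in>{v \<in> V. E v u}. dg u)"
    by (intro sum.cong refl) (auto simp: power2_eq_square nbs_def intro: arg_cong[where f = card] E_sym)
  also have "\<dots> = (\<Sum>v\<in>V. \<Sum>u\<in>nb v. dg u)"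
    unfolding nbs_def by (rule sum.swap_restrict[symmetric]) auto
  finally have "(\<Sum>v\<in>V. (dg v)\<^sup>2) + card V = (\<Sum>v\<in>V. (\<Sum>u\<in>nb v. dg u) + 1)"
    by (simp only: sum.distrib) simp
  also have "\<dots> \<le> (\<Sum>v\<in>V. card V)"
    by (intro sum_mono sum_nb_degree_less)
  finally show ?thesis
    by (simp add: power2_eq_square)
qed

text \<open>Linearises the bound on squares through \<open>(d - 2)\<^sup>2 \<ge> 0\<close>. It later
  bounds the number of edges inside \<open>far\<close>.\<close>

lemma four_sum_degree_le: "4 * (\<Sum>v\<in>V. dg v) \<le> card V * (card V + 3)"
proof -
  have "4 * d \<le> d\<^sup>2 + 4" for d :: nat
    using zero_le_power2[of "int d - 2"] by (simp add: power2_diff flip: of_nat_le_iff[where 'a = int])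
  then have "4 * (\<Sum>v\<in>V. dg v) \<le> (\<Sum>v\<in>V. (dg v)\<^sup>2 + 4)"
    by (simp only: sum_distrib_left sum_mono)
  also have "\<dots> = (\<Sum>v\<in>V. (dg v)\<^sup>2) + 4 * card V"
    by (simp add: sum.distrib)
  also have "\<dots> \<le> card V * (card V + 3)"
    using sum_degree_squares by (simp add: power2_eq_square algebra_simps)
  finally show ?thesis .
qed

text \<open>With \<open>S \<le> 2 k + 2\<close> the claim becomes
  \<open>(k - D) (D - 2 - 2 / k) \<ge> 0\<close>; the constant is the one for which
  \<open>D = k\<close> is a root. The product is negative at \<open>D = 2\<close>, where the sharper
  \<open>S \<le> 2 k\<close> takes over.\<close>

lemma degree_supersolution:
  assumes V: "card V = 2 * k + 3" and k: "3 \<le> k"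
    and v: "v \<in> V" "2 \<le> dg v" and max: "\<And>u. u \<in> V \<Longrightarrow> dg u \<le> k"
  shows "laplace_op V E (\<lambda>u. real (dg u)) v \<le> (real k + 2 + 2 / real k) * real (dg v)"
proof -
  define D where "D = real (dg v)"
  define S where "S = (\<Sum>u\<in>nb v. real (dg u))"
  have S1: "S \<le> 2 * real k + 2"
    using sum_nb_degree_less[OF v(1)] V unfolding S_def by (simp flip: of_nat_sum)
  have S2: "S \<le> D * real k"
    unfolding S_def D_def by (rule sum_bounded_above) (use max in \<open>auto simp: nbs_def\<close>)
  have D: "2 \<le> D" "D \<le> real k"
    using v max by (auto simp: D_def)
  have "D * D + S \<le> (real k + 2 + 2 / real k) * D"
  proof (cases "dg v = 2")
    case True
    then have "S \<le> 2 * real k"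
      using S2 by (simp add: D_def)
    also have "\<dots> \<le> 2 * real k + 4 / real k"
      by simp
    finally show ?thesis
      using True by (simp add: D_def algebra_simps)
  next
    case False
    then have "3 \<le> D" using v by (simp add: D_def)
    moreover have "2 / real k \<le> 1" using k by simp
    ultimately have "(real k - D) * (D - 2 - 2 / real k) \<ge> 0"
      using D by (intro mult_nonneg_nonneg) linarith+
    moreover have "(real k - D) * (D - 2 - 2 / real k) =
        (real k + 2 + 2 / real k) * D - D * D - (2 * real k + 2)"
      using k by (simp add: field_simps)
    ultimately show ?thesis using S1 by linarith
  qed
  then show ?thesis by (simp add: laplace_op_def D_def S_def)
qed

end

section \<open>A vertex of the largest possible degree\<close>

locale girth5_hub = girth5 +
  fixes k :: nat and x :: 'a
  assumes card_V: "card V = 2 * k + 3"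
    and k_ge: "10 \<le> k"
    and x_in: "x \<in> V"
    and dg_x: "k + 1 \<le> dg x"
    and dg_ge2: "v \<in> V \<Longrightarrow> 2 \<le> dg v"
begin

section \<open>Structure forced by a vertex of degree \<open>k + 1\<close>\<close>

definition "far = V - insert x (nb x)"

text \<open>Meaningful for \<open>u\<close> in \<open>nb x\<close>: such a vertex has degree two,
  hence exactly one neighbour besides \<open>x\<close>.\<close>

definition "partner u = (THE p. p \<in> nb u \<and> p \<noteq> x)"

lemma x_notin_nb [simp]: "x \<notin> nb x"
  by (simp add: nbs_def E_irrefl)

text \<open>The neighbour-degree sum at \<open>x\<close> is squeezed between \<open>2 * dg x\<close>
  and \<open>2 k + 2\<close>, so equality holds in every term.\<close>

lemma card_nb_x: "dg x = k + 1"
  and dg_near: "u \<in> nb x \<Longrightarrow> dg u = 2"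
proof -
  have ge: "2 \<le> dg u" if "u \<in> nb x" for u
    using that dg_ge2[of u] by (simp add: nbs_def)
  have "2 * dg x = (\<Sum>u\<in>nb x. 2)"
    by simp
  also have "\<dots> \<le> (\<Sum>u\<in>nb x. dg u)"
    using ge by (intro sum_mono)
  finally have le: "2 * dg x \<le> (\<Sum>u\<in>nb x. dg u)" .
  have le': "(\<Sum>u\<in>nb x. dg u) \<le> 2 * k + 2"
    using sum_nb_degree_less[OF x_in] card_V by simp
  show *: "dg x = k + 1"
    using le le' dg_x by simp
  assume u: "u \<in> nb x"
  have "(\<Sum>u\<in>nb x. dg u) = (\<Sum>u\<in>nb x. 2)"
    using le le' * by simp
  then show "dg u = 2"
    using sum_mono_inv[of "\<lambda>_. 2" "nb x" dg u] ge u by simp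
qed

lemma card_far: "card far = k + 1"
proof -
  have "card far = card V - card (insert x (nb x))"
    unfolding far_def using x_in nbs_subset[of V E x] by (intro card_Diff_subset) auto
  then show ?thesis
    using card_V card_nb_x by simp
qed

text \<open>The second neighbour of \<open>u\<close> lies outside \<open>nb x\<close>, since
  otherwise it would close a triangle with \<open>x\<close> and \<open>u\<close>.\<close>

lemma near_nb:
  assumes u: "u \<in> nb x"
  shows "nb u = {x, partner u}" "partner u \<in> far" "E u (partner u)"
proof -
  have xu: "x \<in> nb u"
    using u x_in by (auto simp: nbs_def dest: E_sym)
  obtain a b where ab: "nb u = {a, b}" "a \<noteq> b"
    using dg_near[OF u] by (auto simp: card_2_iff)
  then obtain p where p: "nb u = {x, p}" "p \<noteq> x"
    using xu by (cases "x = a") auto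
  have "partner u = p"
    unfolding partner_def using p by (intro the_equality) auto
  with p show 1: "nb u = {x, partner u}" by simp
  have "p \<in> nb u" using p by simp
  then have up: "E u p" "p \<in> V" by (auto simp: nbs_def)
  have "p \<notin> nb x"
    using u up no_triangle[of x u p] by (auto simp: nbs_def dest: E_sym)
  with up p \<open>partner u = p\<close> show "partner u \<in> far" "E u (partner u)"
    by (auto simp: far_def)
qed

text \<open>Two neighbours of \<open>x\<close> with a common partner would form a square with it and
  \<open>x\<close>.\<close>

lemma partner_inj: "inj_on partner (nb x)"
proof (rule inj_onI)
  fix u u' assume u: "u \<in> nb x" "u' \<in> nb x" "partner u = partner u'"
  have "x \<noteq> partner u"
    using near_nb(2)[OF u(1)] by (auto simp: far_def)
  moreover have "E x u" "E u' x"
    using u by (auto simp: nbs_def dest: E_sym)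
  ultimately show "u = u'"
    using no_square[of x u "partner u" u'] near_nb(3)[OF u(1)] near_nb(3)[OF u(2)] u(3)
    by (auto dest: E_sym)
qed

lemma bij_partner: "bij_betw partner (nb x) far"
proof -
  have "partner ` nb x \<subseteq> far" using near_nb(2) by auto
  moreover have "card (partner ` nb x) = card far"
    using card_image[OF partner_inj] card_nb_x card_far by simp
  ultimately have "partner ` nb x = far"
    by (intro card_subset_eq) (auto simp: far_def)
  then show ?thesis
    using partner_inj by (simp add: bij_betw_def)
qed

lemma far_obtain:
  assumes "y \<in> far"
  obtains u where "u \<in> nb x" "y = partner u"
  using assms bij_partner by (auto simp: bij_betw_def)

text \<open>Girth at least five passes to induced subgraphs, so the counting bounds also hold for
  the degrees inside \<open>far\<close>.\<close>

sublocale F: girth5 far E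
  by unfold_locales (auto simp: far_def intro: E_sym E_irrefl dest: no_triangle no_square)

text \<open>A further neighbour in \<open>nb x\<close> would have the same partner as
  \<open>u\<close>, against injectivity; so only one edge leaves \<open>far\<close> at each of its
  vertices.\<close>

lemma far_nb:
  assumes u: "u \<in> nb x"
  shows "nb (partner u) = insert u (F.nb (partner u))" "u \<notin> F.nb (partner u)"
proof -
  note pu = near_nb[OF u]
  have "t = u \<or> t \<in> far" if t: "t \<in> nb (partner u)" for t
  proof (cases "t \<in> nb x")
    case True
    have "partner u \<in> nb t"
      using t pu(2) by (auto simp: nbs_def far_def dest: E_sym)
    then have "partner u = partner t"
      using near_nb[OF True] pu(2) by (auto simp: far_def)
    then show ?thesis
      using partner_inj True u by (auto dest: inj_onD)
  next
    case False
    have "t \<noteq> x"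
      using t pu(2) by (auto simp: nbs_def far_def dest: E_sym)
    then show ?thesis
      using False t by (auto simp: far_def nbs_def)
  qed
  moreover have "u \<in> nb (partner u)"
    using u pu(3) by (auto simp: nbs_def dest: E_sym)
  ultimately show "nb (partner u) = insert u (F.nb (partner u))"
    by (auto simp: nbs_def far_def)
  show "u \<notin> F.nb (partner u)"
    using u by (auto simp: nbs_def far_def)
qed

lemma dg_partner: "u \<in> nb x \<Longrightarrow> dg (partner u) = F.dg (partner u) + 1"
  using far_nb[of u] by simp

lemma V_cases:
  assumes "v \<in> V"
  obtains "v = x" | "v \<in> nb x" | u where "u \<in> nb x" "v = partner u"
  using assms far_obtain[of v] by (auto simp: far_def)

lemma partner_notin: "u \<in> nb x \<Longrightarrow> partner u \<noteq> x" "u \<in> nb x \<Longrightarrow> partner u \<notin> nb x"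
  using near_nb(2) by (auto simp: far_def)

lemma sum_partner: "(\<Sum>u\<in>nb x. f (partner u)) = (\<Sum>y\<in>far. f y)"
  by (rule sum.reindex_bij_betw[OF bij_partner])

section \<open>A supersolution when \<open>x\<close> is the only vertex of degree
  \<open>k + 1\<close>\<close>

text \<open>The condition at \<open>x\<close>: \<open>K\<close> stands for \<open>k\<close> and
  \<open>T\<close> for the degree sum inside \<open>far\<close>. The bound on \<open>T\<close> gives
  \<open>2 T + K + 1 \<le> (K + 2) (K - 1)\<close>.\<close>

lemma hub_inequality:
  fixes K T :: real
  assumes K: "10 \<le> K" and T: "4 * T \<le> (K + 1) * (K + 4)"
  shows "((K + 1) * (K * (K - 1)) + 2 * T + K + 1) / (K + 2 / K) \<le> (1 + 2 / K) * (K * (K - 1))"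
proof -
  have c: "0 < K + 2 / K" using K by (simp add: add_pos_pos)
  have "10 * K \<le> K * K"
    using K by (intro mult_right_mono) auto
  moreover have "4 * T \<le> K * K + 5 * K + 4"
    using T by (simp add: algebra_simps)
  ultimately have "2 * T + K + 1 \<le> K * K + K - 2"
    using K by linarith
  then have 1: "2 * T + K + 1 \<le> (K + 2) * (K - 1)"
    by (simp add: algebra_simps)
  have "(1 + 2 / K) * (K * (K - 1)) * (K + 2 / K) = ((1 + 2 / K) * K) * ((K - 1) * (K + 2 / K))"
    by (simp only: mult_ac)
  also have "(1 + 2 / K) * K = K + 2"
    using K by (simp add: field_simps)
  also have "(K + 2) * ((K - 1) * (K + 2 / K)) = (K + 2) * (K - 1) * K + 2 * (K - 1) * ((K + 2) / K)"
    by (simp add: divide_inverse algebra_simps)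
  \<comment> \<open>Bounding \<open>(K + 2) / K\<close> below by 1 leaves exactly the upper bound
    for the numerator.\<close>
  also have "\<dots> \<ge> (K + 2) * (K - 1) * K + 2 * (K - 1) * 1"
    using K by (intro add_left_mono mult_left_mono) auto
  finally have "(K + 2) * (K - 1) * K + 2 * (K - 1) * 1 \<le> (1 + 2 / K) * (K * (K - 1)) * (K + 2 / K)" .
  moreover have "(K + 1) * (K * (K - 1)) + 2 * T + K + 1 \<le> (K + 1) * (K * (K - 1)) + (K + 2) * (K - 1)"
    using 1 by simp
  moreover have "(K + 1) * (K * (K - 1)) + (K + 2) * (K - 1) = (K + 2) * (K - 1) * K + 2 * (K - 1) * 1"
    by (simp add: algebra_simps)
  ultimately show ?thesis
    unfolding pos_divide_le_eq[OF c] by simp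
qed

text \<open>The condition at a vertex of \<open>far\<close> with \<open>F\<close>-degree
  \<open>d\<close>: its degree is \<open>d + 1\<close> and its weight \<open>2 d + 1\<close>. The
  term \<open>K - 1 + (2 d + 1) / K\<close> bounds the weight of its neighbour in
  \<open>nb x\<close>, and \<open>2 K + d\<close> the total weight of those in
  \<open>far\<close>.\<close>

lemma far_inequality:
  fixes K d :: real
  assumes d: "1 \<le> d" "d \<le> K - 1"
  shows "(d + 1) * (2 * d + 1) + (K - 1 + (2 * d + 1) / K + (2 * K + d)) \<le>
    (K + 2 + 2 / K) * (2 * d + 1)"
proof -
  have "0 \<le> (d - 1) * (K - 1 - d)" "0 \<le> (2 * d + 1) / K"
    using d by auto
  moreover have "(K + 2 + 2 / K) * (2 * d + 1) -
      ((d + 1) * (2 * d + 1) + (K - 1 + (2 * d + 1) / K + (2 * K + d)))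
    = 2 * ((d - 1) * (K - 1 - d)) + (2 * d + 1) / K"
    by (simp add: divide_inverse algebra_simps)
  ultimately show ?thesis by linarith
qed

text \<open>The weights of the neighbours of \<open>x\<close> solve their equations exactly for the eigenvalue
  \<open>k + 2 + 2 / k\<close>; the weight of \<open>x\<close> is chosen such that the inequality at a vertex of degree \<open>d\<close>
  in \<open>far\<close> reduces to \<open>(d - 1) (k - 1 - d) \<ge> 0\<close>.\<close>

definition hub_weight :: "'a \<Rightarrow> real" where
  "hub_weight v =
     (if v = x then real k * (real k - 1)
      else if v \<in> nb x
        then (real k * (real k - 1) + (2 * real (F.dg (partner v)) + 1)) / (real k + 2 / real k)
      else 2 * real (F.dg v) + 1)"

lemma hub_weight_pos: "0 < hub_weight v"
proof -
  have "0 < real k * (real k - 1)" "0 < real k + 2 / real k"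
    using k_ge by (auto simp: add_pos_pos)
  then show ?thesis
    by (auto simp: hub_weight_def add_pos_nonneg)
qed

lemma hub_weight_simps:
  "hub_weight x = real k * (real k - 1)"
  "u \<in> nb x \<Longrightarrow> hub_weight u =
     (real k * (real k - 1) + (2 * real (F.dg (partner u)) + 1)) / (real k + 2 / real k)"
  "y \<in> far \<Longrightarrow> hub_weight y = 2 * real (F.dg y) + 1"
  by (auto simp: hub_weight_def far_def)

lemma hub_weight_supersolution:
  assumes small: "\<And>v. v \<in> V \<Longrightarrow> v \<noteq> x \<Longrightarrow> dg v \<le> k" and v: "v \<in> V"
  shows "laplace_op V E hub_weight v \<le> (real k + 2 + 2 / real k) * hub_weight v"
  using v
proof (cases rule: V_cases)
  case 1
  let ?K = "real k" and ?c = "real k + 2 / real k"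
  have c: "0 < ?c" using k_ge by (simp add: add_pos_pos)
  define T where "T = (\<Sum>y\<in>far. real (F.dg y))"
  have "4 * real (\<Sum>v\<in>far. F.dg v) \<le> real (k + 1) * real (k + 1 + 3)"
    using F.four_sum_degree_le unfolding card_far
    by (metis of_nat_le_iff of_nat_mult of_nat_numeral)
  then have T: "4 * T \<le> (?K + 1) * (?K + 4)"
    by (simp add: T_def algebra_simps)
  have "(\<Sum>u\<in>nb x. hub_weight u) =
      (\<Sum>u\<in>nb x. (?K * (?K - 1) + (2 * real (F.dg (partner u)) + 1)) / ?c)"
    by (intro sum.cong refl hub_weight_simps(2))
  also have "\<dots> = (\<Sum>y\<in>far. (?K * (?K - 1) + (2 * real (F.dg y) + 1)) / ?c)"
    by (rule sum_partner)
  also have "\<dots> = ((?K + 1) * (?K * (?K - 1)) + 2 * T + ?K + 1) / ?c"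
  proof -
    have "(\<Sum>y\<in>far. W + (2 * real (F.dg y) + 1)) = (?K + 1) * W + 2 * T + ?K + 1" for W
      by (simp add: sum.distrib card_far T_def sum_distrib_left)
    then show ?thesis
      unfolding sum_divide_distrib[symmetric] by simp
  qed
  also have "\<dots> \<le> (1 + 2 / ?K) * (?K * (?K - 1))"
    using k_ge T by (intro hub_inequality) auto
  finally show ?thesis
    using 1 card_nb_x by (simp add: laplace_op_def hub_weight_simps algebra_simps)
next
  case 2
  have c: "0 < real k + 2 / real k"
    using k_ge by (simp add: add_pos_pos)
  have "laplace_op V E hub_weight v = 2 * hub_weight v + (hub_weight x + hub_weight (partner v))"
    using near_nb(1)[OF 2] partner_notin(1)[OF 2] by (simp add: laplace_op_def dg_near[OF 2])
  also have "hub_weight x + hub_weight (partner v) = (real k + 2 / real k) * hub_weight v"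
    using c unfolding hub_weight_simps(1) hub_weight_simps(2)[OF 2]
      hub_weight_simps(3)[OF near_nb(2)[OF 2]] by simp
  finally show ?thesis by (simp add: algebra_simps)
next
  case (3 u)
  let ?K = "real k" and ?c = "real k + 2 / real k"
  have y: "v \<in> far" using 3 near_nb(2) by simp
  define d where "d = real (F.dg v)"
  \<comment> \<open>One edge at \<open>v\<close> leads to \<open>nb x\<close>, so both degree bounds
    drop by one inside \<open>far\<close>.\<close>
  have "1 \<le> F.dg v" "F.dg v \<le> k - 1"
    using dg_ge2[OF v] small[OF v] 3 dg_partner[of u] partner_notin(1)[of u] by auto
  then have d: "1 \<le> d" "d \<le> ?K - 1"
    using k_ge unfolding d_def by linarith+
  have c: "?K \<le> ?c" "0 < ?K" "0 < ?c" using k_ge by (auto simp: add_pos_pos)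
  have wx: "0 \<le> ?K * (?K - 1)" using k_ge by simp
  have "(\<Sum>t\<in>F.nb v. real (F.dg t)) \<le> ?K"
    using F.sum_nb_degree_less[OF y] by (simp add: card_far flip: of_nat_sum)
  then have "(\<Sum>t\<in>F.nb v. 2 * real (F.dg t) + 1) \<le> 2 * ?K + d"
    by (simp add: sum.distrib d_def flip: sum_distrib_left)
  moreover have "(\<Sum>t\<in>F.nb v. hub_weight t) = (\<Sum>t\<in>F.nb v. 2 * real (F.dg t) + 1)"
    by (intro sum.cong refl) (auto simp: hub_weight_simps nbs_def)
  ultimately have S: "(\<Sum>t\<in>F.nb v. hub_weight t) \<le> 2 * ?K + d" by simp
  have "hub_weight u = (?K * (?K - 1) + (2 * d + 1)) / ?c"
    using 3 by (simp add: hub_weight_simps d_def)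
  \<comment> \<open>The denominator is lowered from \<open>k + 2 / k\<close> to \<open>k\<close>;
    the slack in the inequality at \<open>far\<close> allows it.\<close>
  also have "\<dots> \<le> (?K * (?K - 1) + (2 * d + 1)) / ?K"
    using c d wx by (intro divide_left_mono mult_pos_pos) auto
  also have "\<dots> = ?K - 1 + (2 * d + 1) / ?K"
    using c by (simp add: field_simps)
  finally have U: "hub_weight u \<le> ?K - 1 + (2 * d + 1) / ?K" .
  have "laplace_op V E hub_weight v =
      (d + 1) * (2 * d + 1) + (hub_weight u + (\<Sum>t\<in>F.nb v. hub_weight t))"
  proof -
    have "v = partner u" "u \<in> nb x" using 3 by auto
    then have "nb v = insert u (F.nb v)" "u \<notin> F.nb v"
      using far_nb by auto
    then show ?thesis
      unfolding laplace_op_def hub_weight_simps(3)[OF y] d_def by (simp add: add.commute)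
  qed
  also have "\<dots> \<le> (d + 1) * (2 * d + 1) + (?K - 1 + (2 * d + 1) / ?K + (2 * ?K + d))"
    using S U by simp
  also have "\<dots> \<le> (?K + 2 + 2 / ?K) * (2 * d + 1)"
    using d by (rule far_inequality)
  finally show ?thesis
    unfolding hub_weight_simps(3)[OF y] d_def .
qed

end

section \<open>Two vertices of the largest possible degree\<close>

locale girth5_two_hubs = girth5_hub +
  fixes y :: 'a
  assumes y_in: "y \<in> V" and y_neq: "y \<noteq> x" and dg_y: "k + 1 \<le> dg y"
begin

text \<open>The inner vertex of the path of length two from \<open>x\<close> to \<open>y\<close>,
  unique by injectivity of \<open>partner\<close>.\<close>

definition "mid = (THE u. u \<in> nb x \<and> partner u = y)"

lemma y_far: "y \<in> far"
  using y_in y_neq dg_y dg_near[of y] k_ge by (auto simp: far_def)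

lemma mid: "mid \<in> nb x" "partner mid = y"
proof -
  obtain u where "u \<in> nb x" "y = partner u"
    using far_obtain[OF y_far] .
  then have "mid = u"
    unfolding mid_def using partner_inj by (intro the_equality) (auto dest: inj_onD)
  then show "mid \<in> nb x" "partner mid = y"
    using \<open>u \<in> nb x\<close> \<open>y = partner u\<close> by auto
qed

text \<open>One of the \<open>k + 1\<close> edges at \<open>y\<close> goes to \<open>mid\<close>;
  the other \<open>k\<close> must exhaust the rest of \<open>far\<close>.\<close>

lemma F_nb_y: "F.nb y = far - {y}"
proof (rule card_subset_eq)
  show "F.nb y \<subseteq> far - {y}"
    by (auto simp: nbs_def E_irrefl)
  then have "F.dg y \<le> card (far - {y})"
    by (intro card_mono) auto
  moreover have "card (far - {y}) = k"
    using card_far y_far by simp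
  moreover have "k \<le> F.dg y"
    using dg_y dg_partner[OF mid(1)] mid(2) by simp
  ultimately show "F.dg y = card (far - {y})" by simp
qed simp

text \<open>Two adjacent vertices of \<open>far\<close> other than \<open>y\<close> would close a
  triangle with \<open>y\<close>, so \<open>far\<close> induces a star.\<close>

lemma F_nb_other:
  assumes z: "z \<in> far" "z \<noteq> y"
  shows "F.nb z = {y}"
proof -
  have yz: "E y t" if "t \<in> far" "t \<noteq> y" for t
    using that F_nb_y by (auto simp: nbs_def)
  have "t = y" if "t \<in> F.nb z" for t
    using that no_triangle[of y z t] yz[OF z] yz[of t] by (auto simp: nbs_def dest: E_sym)
  moreover have "y \<in> F.nb z"
    using yz[OF z] y_far by (auto simp: nbs_def dest: E_sym)
  ultimately show ?thesis by blast
qed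

lemma nb_y: "nb y = insert mid (far - {y})" "mid \<notin> far - {y}"
  using far_nb[OF mid(1)] mid F_nb_y by auto

lemma nb_other:
  assumes u: "u \<in> nb x" "u \<noteq> mid"
  shows "nb (partner u) = {u, y}" "u \<noteq> y" "partner u \<noteq> y"
proof -
  have "partner u \<noteq> y"
    using u mid partner_inj by (auto dest: inj_onD)
  then show "nb (partner u) = {u, y}" "partner u \<noteq> y"
    using far_nb(1)[OF u(1)] F_nb_other[OF near_nb(2)[OF u(1)]] by auto
  show "u \<noteq> y"
    using u y_far by (auto simp: far_def)
qed

text \<open>The cubic is the characteristic equation of the reduced eigenvalue problem.\<close>

definition theta_weight :: "real \<Rightarrow> 'a \<Rightarrow> real" where
  "theta_weight q v = (if v = x \<or> v = y then 1 else if v = mid then 2 / (q - 2) else 1 / (q - 3))"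

lemma theta_weight_pos: "3 < q \<Longrightarrow> 0 < theta_weight q v"
  by (auto simp: theta_weight_def)

text \<open>With value 1 at both ends, the equation \<open>q w = 2 w + 2\<close> at
  \<open>mid\<close> and \<open>q w = 2 w + w + 1\<close> on the paths of length three fix the
  weights. The equation at the ends is then the cubic.\<close>

lemma theta_weight_eigen:
  assumes q: "3 < q"
    and root: "q ^ 3 - (real k + 6) * q\<^sup>2 + (4 * real k + 9) * q - 4 * real k = 0"
    and v: "v \<in> V"
  shows "laplace_op V E (theta_weight q) v = q * theta_weight q v"
proof -
  \<comment> \<open>The equation at an end, recovered from the cubic by dividing by
    \<open>(q - 2) (q - 3)\<close>.\<close>
  have main: "real k + 1 + (2 / (q - 2) + real k * (1 / (q - 3))) = q"
  proof -
    have "2 * (q - 3) + real k * (q - 2) = (q - real k - 1) * ((q - 2) * (q - 3))"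
      using root by (simp add: algebra_simps power2_eq_square power3_eq_cube)
    then have "(2 * (q - 3) + real k * (q - 2)) / ((q - 2) * (q - 3)) = q - real k - 1"
      using q by simp
    moreover have "2 / (q - 2) + real k / (q - 3) =
        (2 * (q - 3) + real k * (q - 2)) / ((q - 2) * (q - 3))"
      using q by (subst add_frac_eq) auto
    ultimately show ?thesis by simp
  qed
  have mid_x: "mid \<noteq> x" "mid \<noteq> y"
    using mid y_far by (auto simp: far_def)
  have wx: "theta_weight q x = 1" and wy: "theta_weight q y = 1"
    and wmid: "theta_weight q mid = 2 / (q - 2)"
    using mid_x by (auto simp: theta_weight_def)
  have wnear: "theta_weight q u = 1 / (q - 3)" if "u \<in> nb x" "u \<noteq> mid" for u
    using that y_far by (auto simp: theta_weight_def far_def)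
  have wfar: "theta_weight q z = 1 / (q - 3)" if "z \<in> far" "z \<noteq> y" for z
    using that mid by (auto simp: theta_weight_def far_def)
  from v show ?thesis
  proof (cases rule: V_cases)
    case 1
    have "(\<Sum>u\<in>nb x. theta_weight q u) = theta_weight q mid + (\<Sum>u\<in>nb x - {mid}. theta_weight q u)"
      using mid(1) by (simp add: sum.remove)
    also have "(\<Sum>u\<in>nb x - {mid}. theta_weight q u) = real k * (1 / (q - 3))"
      using mid(1) by (simp add: wnear card_nb_x)
    finally show ?thesis
      using 1 main by (simp add: laplace_op_def card_nb_x wx wmid)
  next
    case 2
    have L: "laplace_op V E (theta_weight q) v = 2 * theta_weight q v + (1 + theta_weight q (partner v))"
      using near_nb(1)[OF 2] partner_notin(1)[OF 2] by (simp add: laplace_op_def dg_near[OF 2] wx)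
    show ?thesis
    proof (cases "v = mid")
      case True
      then show ?thesis unfolding L using q by (simp add: mid(2) wy wmid field_simps)
    next
      case False
      have r: "(q - 3) * (1 / (q - 3)) = 1"
        using q by simp
      show ?thesis
        unfolding L wfar[OF near_nb(2)[OF 2] nb_other(3)[OF 2 False]] wnear[OF 2 False]
        using r by (simp only: algebra_simps)
    qed
  next
    case (3 u)
    show ?thesis
    proof (cases "u = mid")
      case True
      then have vy: "v = y" using 3 mid(2) by simp
      have "card (far - {y}) = k"
        using card_far y_far by simp
      then show ?thesis
        using main nb_y(2) by (simp add: vy laplace_op_def nb_y(1) wy wmid wfar)
    next
      case False
      note o = nb_other[OF 3(1) False]
      have r: "(q - 3) * (1 / (q - 3)) = 1"
        using q by simp
      have "laplace_op V E (theta_weight q) v = 2 * (1 / (q - 3)) + (1 / (q - 3) + 1)"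
        using o(2) unfolding laplace_op_def 3(2) o(1) wfar[OF near_nb(2)[OF 3(1)] o(3)]
        by (simp add: wnear[OF 3(1) False] wy)
      also have "\<dots> = q * (1 / (q - 3))"
        using r by (simp only: algebra_simps)
      finally show ?thesis
        unfolding 3(2) wfar[OF near_nb(2)[OF 3(1)] o(3)] .
    qed
  qed
qed

end

section \<open>The cubic\<close>

text \<open>The cubic of \<open>q_prime\<close> after substituting
  \<open>n = 2 K + 3\<close>.\<close>

definition theta_cubic :: "real \<Rightarrow> real \<Rightarrow> real" where
  "theta_cubic K q = q ^ 3 - (K + 6) * q\<^sup>2 + (4 * K + 9) * q - 4 * K"

text \<open>This form is the eigenvalue equation at an end of the theta graph with denominators
  cleared.\<close>

lemma theta_cubic_factored:
  "theta_cubic K q = (q - K - 1) * ((q - 2) * (q - 3)) - 2 * (q - 3) - K * (q - 2)"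
  by (simp add: theta_cubic_def algebra_simps power2_eq_square power3_eq_cube)

lemma q_prime_odd: "q_prime (2 * k + 3) = Max {q. theta_cubic (real k) q = 0}"
  unfolding q_prime_def
  by (rule arg_cong[where f = Max]) (auto simp: theta_cubic_def algebra_simps add_divide_distrib)

lemma finite_theta_cubic_roots: "finite {q. theta_cubic K q = 0}"
proof -
  have "theta_cubic K q = poly [:-4 * K, 4 * K + 9, -(K + 6), 1:] q" for q
    by (simp add: theta_cubic_def algebra_simps power2_eq_square power3_eq_cube)
  then show ?thesis
    using poly_roots_finite[of "[:-4 * K, 4 * K + 9, -(K + 6), 1:]"] by simp
qed

text \<open>A negative value at the bound for the non-extremal cases forces a root strictly beyond
  it.\<close>

lemma theta_cubic_neg:
  assumes K: "10 \<le> K"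
  shows "theta_cubic K (K + 2 + 2 / K) < 0"
proof -
  \<comment> \<open>Writing \<open>e\<close> for the reciprocal turns the evaluation into polynomial
    algebra modulo \<open>K * e = 1\<close>.\<close>
  define e where "e = 1 / K"
  have e: "K * e = 1" "0 < e" "e \<le> 1 / 10"
    using K by (auto simp: e_def)
  have eq: "2 / K = 2 * e" by (simp add: e_def)
  have "theta_cubic K (K + 2 + 2 / K) =
      - 3 * K + 2 + 2 * K * (K * e) + (8 * (K * e) - 6) * e + 8 * (e * e * e)"
    unfolding theta_cubic_factored eq by (simp add: algebra_simps)
  also have "\<dots> = - K + 2 + 2 * e + 8 * (e * e * e)"
    unfolding e(1) by simp
  also have "\<dots> < 0"
  proof -
    have "e * e * e \<le> 1 * 1 * (1 / 10)"
      using e by (intro mult_mono) auto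
    then show ?thesis using e K by linarith
  qed
  finally show ?thesis .
qed

text \<open>The intermediate value theorem gives a root above the bound, and the largest root is at
  least as large.\<close>

lemma q_prime_root:
  assumes k: "10 \<le> k"
  shows "theta_cubic (real k) (q_prime (2 * k + 3)) = 0"
    and "real k + 2 + 2 / real k < q_prime (2 * k + 3)"
proof -
  let ?K = "real k" and ?R = "{q. theta_cubic (real k) q = 0}"
  let ?b = "?K + 2 + 2 / ?K"
  have neg: "theta_cubic ?K ?b < 0"
    using k by (intro theta_cubic_neg) simp
  \<comment> \<open>At \<open>K + 6\<close> the two leading terms of the cubic cancel.\<close>
  have "theta_cubic ?K (?K + 6) = (4 * ?K + 9) * (?K + 6) - 4 * ?K"
    by (simp add: theta_cubic_def algebra_simps power2_eq_square power3_eq_cube)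
  also have "\<dots> \<ge> 0"
    by (simp add: algebra_simps)
  finally have "0 \<le> theta_cubic ?K (?K + 6)" .
  moreover have "2 / ?K \<le> 1"
    using k by simp
  then have "?b \<le> ?K + 6"
    by linarith
  moreover have "continuous_on {?b..?K + 6} (theta_cubic ?K)"
    unfolding theta_cubic_def by (intro continuous_intros)
  ultimately obtain r where r: "?b \<le> r" "theta_cubic ?K r = 0"
    using neg IVT'[of "theta_cubic ?K" ?b 0 "?K + 6"] by auto
  with neg have "?b < r"
    by (cases "r = ?b") auto
  also have "r \<le> Max ?R"
    using r by (intro Max_ge finite_theta_cubic_roots) simp
  finally show "?b < q_prime (2 * k + 3)"
    by (simp add: q_prime_odd)
  have "Max ?R \<in> ?R"
    using r by (intro Max_in finite_theta_cubic_roots) auto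
  then show "theta_cubic ?K (q_prime (2 * k + 3)) = 0"
    by (simp add: q_prime_odd)
qed

section \<open>Isomorphisms and forbidden cycles\<close>

text \<open>Arcs are pairs of vertices, so an injection on vertices determines the whole
  isomorphism.\<close>

lemma digraph_iso_image:
  assumes "pair_wf_digraph F" and "inj_on g (pverts F)"
    and "pverts H = g ` pverts F" and "parcs H = map_prod g g ` parcs F"
  shows "digraph_iso (with_proj F) (with_proj H)"
proof -
  interpret F: pair_wf_digraph F by fact
  let ?h = "\<lparr>iso_verts = g, iso_arcs = map_prod g g, iso_head = snd, iso_tail = fst\<rparr>"
  have "parcs F \<subseteq> pverts F \<times> pverts F"
    using F.in_arcsD1 F.in_arcsD2 by auto
  then have "inj_on (map_prod g g) (parcs F)"
    using map_prod_inj_on[OF assms(2) assms(2)] inj_on_subset by blast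
  then have "pre_digraph.digraph_isomorphism (with_proj F) ?h"
    using assms(2) F.wf_digraph_axioms by (auto simp: pre_digraph.digraph_isomorphism_def)
  moreover have "with_proj H = app_iso ?h (with_proj F)"
    using assms(3,4) by (simp add: with_proj_def app_iso_def)
  ultimately show ?thesis
    unfolding digraph_iso_def by blast
qed

lemma pair_wf_cycle_graph: "pair_wf_digraph (cycle_graph r)"
  by unfold_locales (auto simp: cycle_graph_def)

lemma (in pair_wf_digraph) contains_cycle_graph:
  assumes g: "inj_on g {..<r}" "g ` {..<r} \<subseteq> pverts G"
    and arcs: "\<And>i j. (i, j) \<in> parcs (cycle_graph r) \<Longrightarrow> (g i, g j) \<in> parcs G"
  shows "contains_subgraph G (cycle_graph r)"
proof -
  let ?F = "cycle_graph r"
  let ?H = "\<lparr>pverts = g ` pverts ?F, parcs = map_prod g g ` parcs ?F\<rparr>"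
  interpret F: pair_wf_digraph ?F by (rule pair_wf_cycle_graph)
  have wf: "wf_digraph (with_proj ?H)"
    unfolding wf_digraph_wp_iff by unfold_locales (auto dest: F.in_arcsD1 F.in_arcsD2)
  have "subgraph (with_proj ?H) (with_proj G)"
    unfolding subgraph_def compatible_def
    using wf wf_digraph_axioms g arcs by (auto simp: cycle_graph_def)
  moreover have "digraph_iso (with_proj ?F) (with_proj ?H)"
    using g by (intro digraph_iso_image[of _ g] pair_wf_cycle_graph) (auto simp: cycle_graph_def)
  then have "digraph_iso (with_proj ?H) (with_proj ?F)"
    by (rule digraph_iso_swap[OF F.wf_digraph_axioms])
  ultimately show ?thesis
    unfolding contains_subgraph_def by blast
qed

context pair_graph
begin

lemma adj_in_verts: "adj G a b \<Longrightarrow> a \<in> pverts G" "adj G a b \<Longrightarrow> b \<in> pverts G"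
  by (auto simp: adj_def dest: in_arcsD1 in_arcsD2)

lemma triangle_contains_cycle_graph:
  assumes "adj G a b" "adj G b c" "adj G c a"
  shows "contains_subgraph G (cycle_graph 3)"
proof (rule contains_cycle_graph)
  let ?g = "\<lambda>i. [a, b, c] ! i"
  have d: "a \<noteq> b" "b \<noteq> c" "c \<noteq> a"
    using assms by (auto simp: adj_def dest: no_loops')
  have lt: "i = 0 \<or> i = 1 \<or> i = 2" if "i < 3" for i :: nat
    using that by arith
  show "inj_on ?g {..<3}"
    using d by (auto simp: inj_on_def dest!: lt)
  show "?g ` {..<3} \<subseteq> pverts G"
    using assms by (auto dest!: lt dest: adj_in_verts)
  show "(?g i, ?g j) \<in> parcs G" if "(i, j) \<in> parcs (cycle_graph 3)" for i j
    using that assms assms[THEN adj_sym] by (auto simp: cycle_graph_def adj_def dest!: lt)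
qed

lemma square_contains_cycle_graph:
  assumes "adj G a b" "adj G b c" "adj G c d" "adj G d a" "a \<noteq> c" "b \<noteq> d"
  shows "contains_subgraph G (cycle_graph 4)"
proof (rule contains_cycle_graph)
  let ?g = "\<lambda>i. [a, b, c, d] ! i"
  have d: "a \<noteq> b" "b \<noteq> c" "c \<noteq> d" "d \<noteq> a"
    using assms by (auto simp: adj_def dest: no_loops')
  have lt: "i = 0 \<or> i = 1 \<or> i = 2 \<or> i = 3" if "i < 4" for i :: nat
    using that by arith
  show "inj_on ?g {..<4}"
    using d assms(5,6) by (auto simp: inj_on_def numeral_3_eq_3 dest!: lt)
  show "?g ` {..<4} \<subseteq> pverts G"
    using assms by (auto simp: numeral_3_eq_3 dest!: lt dest: adj_in_verts)
  show "(?g i, ?g j) \<in> parcs G" if "(i, j) \<in> parcs (cycle_graph 4)" for i j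
  proof -
    have ij: "i < 4" "j < 4" and step: "j = (i + 1) mod 4 \<or> i = (j + 1) mod 4"
      using that by (auto simp: cycle_graph_def)
    have "(i, j) \<in> {(0, 1), (1, 2), (2, 3), (3, 0), (1, 0), (2, 1), (3, 2), (0, 3)}"
      using lt[OF ij(1)] lt[OF ij(2)] step by (elim disjE; simp)
    then show ?thesis
      using assms(1-4) assms(1-4)[THEN adj_sym] by (auto simp: adj_def)
  qed
qed

lemma girth5_if_free:
  assumes "free_of {cycle_graph 3, cycle_graph 4} G"
  shows "girth5 (pverts G) (adj G)"
proof
  show "\<not> adj G a a" for a
    by (auto simp: adj_def dest: no_loops')
  show "\<not> adj G c a" if "adj G a b" "adj G b c" for a b c
    using that triangle_contains_cycle_graph assms by (auto simp: free_of_def)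
  show "a = c \<or> b = d" if "adj G a b" "adj G b c" "adj G c d" "adj G d a" for a b c d
    using that square_contains_cycle_graph assms by (auto simp: free_of_def)
qed (use pair_finite_verts adj_sym in auto)

text \<open>Connectedness with a second vertex excludes degree 0: the first arc of a walk to that
  vertex leaves \<open>v\<close>. Degree 1 is a pendant vertex.\<close>

lemma degree_ge_two:
  assumes con: "Digraph_Component.connected (with_proj G)"
    and pend: "\<not> has_pendant_vertex G"
    and card: "2 \<le> card (pverts G)" and v: "v \<in> pverts G"
  shows "2 \<le> card (nbs (pverts G) (adj G) v)"
proof -
  obtain w where w: "w \<in> pverts G" "w \<noteq> v"
    using card v by (metis card_le_Suc0_iff_eq not_less_eq_eq numeral_2_eq_2 pair_finite_verts)
  have "strongly_connected (with_proj G)"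
    using sym_arcs con by (rule symmetric_connected_imp_strongly_connected)
  then have "(v, w) \<in> rtrancl_on (pverts G) (parcs G)"
    using v w by (auto simp: strongly_connected_def reachable_def)
  then have "(v, w) \<in> (parcs G)\<^sup>*"
    by (rule rtrancl_on_rtranclI)
  then obtain z where "(v, z) \<in> parcs G"
    using w by (auto elim: converse_rtranclE)
  then have "z \<in> nbs (pverts G) (adj G) v"
    by (auto simp: nbs_def adj_def dest: in_arcsD2)
  then have "card (nbs (pverts G) (adj G) v) \<noteq> 0"
    using pair_finite_verts by auto
  moreover have "card (nbs (pverts G) (adj G) v) \<noteq> 1"
    using pend v by (auto simp: has_pendant_vertex_def out_degree_eq_card_nbs)
  ultimately show ?thesis by linarith
qed

end

section \<open>The theta graph\<close>

text \<open>Path 0 has length two and the single inner vertex \<open>Inner 0 1\<close>; paths 1 to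
  \<open>k\<close> have length three and two inner vertices each.\<close>

abbreviation theta23 :: "nat \<Rightarrow> theta_vertex pair_pre_digraph" where
  "theta23 k \<equiv> theta_graph (2 # replicate k 3)"

lemma theta23_lengths: "i \<le> k \<Longrightarrow> (2 # replicate k 3) ! i = (if i = 0 then 2 else 3)"
  by (cases i) auto

lemma theta23_verts:
  "pverts (theta23 k) =
     {Left_End, Right_End} \<union> (\<lambda>i. Inner i 1) ` {..k} \<union> (\<lambda>i. Inner i 2) ` {1..k}"
proof -
  have "{Inner i j |i j. i < Suc k \<and> 0 < j \<and> j < (2 # replicate k 3) ! i} =
      (\<lambda>i. Inner i 1) ` {..k} \<union> (\<lambda>i. Inner i 2) ` {1..k}" (is "?L = ?R")
  proof
    show "?L \<subseteq> ?R"
    proof clarify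
      fix i j :: nat
      assume "i < Suc k" "0 < j" "j < (2 # replicate k 3) ! i"
        and no2: "Inner i j \<notin> (\<lambda>i. Inner i 2) ` {1..k}"
      then have i: "i \<le> k" and "0 < j \<and> j < (if i = 0 then 2 else 3)"
        by (simp_all only: theta23_lengths less_Suc_eq_le)
      then have "j = 1 \<or> j = 2 \<and> 1 \<le> i"
        by presburger
      with i no2 show "Inner i j \<in> (\<lambda>i. Inner i 1) ` {..k}"
        by auto
    qed
    show "?R \<subseteq> ?L"
      by (auto simp: theta23_lengths)
  qed
  then show ?thesis
    by (simp add: theta_graph_def Let_def Un_assoc)
qed

lemma theta23_arcs:
  "parcs (theta23 k) =
     (let R = (\<lambda>i. (Left_End, Inner i 1)) ` {..k} \<union> {(Inner 0 1, Right_End)} \<union>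
              (\<lambda>i. (Inner i 1, Inner i 2)) ` {1..k} \<union> (\<lambda>i. (Inner i 2, Right_End)) ` {1..k}
      in R \<union> R\<inverse>)"
proof -
  let ?p = "theta_pos (2 # replicate k 3)"
  have "{(?p i j, ?p i (j + 1)) |i (j :: nat). i < Suc k \<and> j < (2 # replicate k 3) ! i} =
      (\<lambda>i. (Left_End, Inner i 1)) ` {..k} \<union> {(Inner 0 1, Right_End)} \<union>
      (\<lambda>i. (Inner i 1, Inner i 2)) ` {1..k} \<union> (\<lambda>i. (Inner i 2, Right_End)) ` {1..k}"
    (is "?L = ?R")
  proof
    show "?L \<subseteq> ?R"
    proof
      fix z assume "z \<in> ?L"
      then obtain i j :: nat where z: "z = (?p i j, ?p i (j + 1))"
        and ij: "i < Suc k" "j < (2 # replicate k 3) ! i"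
        by blast
      from ij have i: "i \<le> k" and "j < (if i = 0 then 2 else 3)"
        by (simp_all only: theta23_lengths less_Suc_eq_le)
      then have "i = 0 \<and> (j = 0 \<or> j = 1) \<or> (1 \<le> i \<and> i \<le> k) \<and> (j = 0 \<or> j = 1 \<or> j = 2)"
        by presburger
      with i have "(?p i j, ?p i (j + 1)) \<in> ?R"
        by (elim disjE conjE) (auto simp: theta_pos_def theta23_lengths)
      then show "z \<in> ?R"
        unfolding z .
    qed
    have 1: "(Left_End, Inner i 1) \<in> ?L" if "i \<in> {..k}" for i
      using that by (intro CollectI exI[of _ i] exI[of _ 0]) (auto simp: theta_pos_def theta23_lengths)
    have 2: "(Inner 0 1, Right_End) \<in> ?L"
      by (intro CollectI exI[of _ 0] exI[of _ 1]) (auto simp: theta_pos_def)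
    have 3: "(Inner i 1, Inner i 2) \<in> ?L" if "i \<in> {1..k}" for i
      using that by (intro CollectI exI[of _ i] exI[of _ 1]) (auto simp: theta_pos_def theta23_lengths)
    have 4: "(Inner i 2, Right_End) \<in> ?L" if "i \<in> {1..k}" for i
      using that by (intro CollectI exI[of _ i] exI[of _ 2]) (auto simp: theta_pos_def theta23_lengths)
    show "?R \<subseteq> ?L"
      by (intro Un_least image_subsetI 1 3 4) (use 2 in \<open>simp_all only: insert_subset empty_subsetI simp_thms\<close>)
  qed
  then show ?thesis
    by (simp add: theta_graph_def Let_def)
qed

lemma theta23_nbs:
  "parcs (theta23 k) `` {Left_End} = (\<lambda>i. Inner i 1) ` {..k}"
  "parcs (theta23 k) `` {Right_End} = insert (Inner 0 1) ((\<lambda>i. Inner i 2) ` {1..k})"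
  "parcs (theta23 k) `` {Inner 0 1} = {Left_End, Right_End}"
  "i \<in> {1..k} \<Longrightarrow> parcs (theta23 k) `` {Inner i 1} = {Left_End, Inner i 2}"
  "i \<in> {1..k} \<Longrightarrow> parcs (theta23 k) `` {Inner i 2} = {Inner i 1, Right_End}"
  unfolding theta23_arcs Let_def by (auto simp: image_iff)

lemma pair_wf_theta23: "pair_wf_digraph (theta23 k)"
  by unfold_locales (auto simp: theta23_arcs theta23_verts Let_def)

lemma out_degree_theta23:
  "out_degree (with_proj (theta23 k)) Left_End = k + 1"
  "out_degree (with_proj (theta23 k)) Right_End = k + 1"
proof -
  have out: "out_degree (with_proj (theta23 k)) t = card (parcs (theta23 k) `` {t})" for t
  proof -
    have "out_arcs (with_proj (theta23 k)) t = Pair t ` (parcs (theta23 k) `` {t})"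
      by (auto simp: out_arcs_def)
    then show ?thesis
      by (simp add: out_degree_def card_image inj_on_def)
  qed
  show "out_degree (with_proj (theta23 k)) Left_End = k + 1"
    unfolding out theta23_nbs by (subst card_image) (auto simp: inj_on_def)
  have "card ((\<lambda>i. Inner i 2) ` {1..k}) = k"
    by (subst card_image) (auto simp: inj_on_def)
  then show "out_degree (with_proj (theta23 k)) Right_End = k + 1"
    unfolding out theta23_nbs by (subst card_insert_disjoint) auto
qed

text \<open>Serves to make a map from these vertices onto a set of \<open>2 * k + 3\<close> elements
  injective.\<close>

lemma card_theta23_verts: "card (pverts (theta23 k)) \<le> 2 * k + 3"
proof -
  have "card (pverts (theta23 k)) \<le>
      card {Left_End, Right_End} + card ((\<lambda>i. Inner i 1) ` {..k}) + card ((\<lambda>i. Inner i 2) ` {1..k})"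
    unfolding theta23_verts by (intro order_trans[OF card_Un_le] add_right_mono card_Un_le)
  also have "\<dots> \<le> 2 + (k + 1) + k"
    using card_image_le[of "{..k}" "\<lambda>i. Inner i 1"] card_image_le[of "{1..k}" "\<lambda>i. Inner i 2"]
    by (intro add_mono) auto
  finally show ?thesis by simp
qed

section \<open>Recognising the theta graph by its two vertices of degree
  \<open>k + 1\<close>\<close>

context girth5_two_hubs
begin

text \<open>The ends go to \<open>x\<close> and \<open>y\<close>, the first inner vertices to
  \<open>nb x\<close> with \<open>mid\<close> on path 0, and the second inner vertices to the
  partners of the first.\<close>

lemma theta23_embedding:
  obtains g where "bij_betw g (pverts (theta23 k)) V"
    and "\<And>t. t \<in> pverts (theta23 k) \<Longrightarrow> g ` (parcs (theta23 k) `` {t}) = nb (g t)"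
proof -
  have "card (nb x - {mid}) = card {1..k}"
    using mid(1) card_nb_x by simp
  then obtain e where e: "bij_betw e {1..k} (nb x - {mid})"
    using finite_same_card_bij[of "{1..k}" "nb x - {mid}"] by auto
  \<comment> \<open>Index 0 lies outside \<open>{1..k}\<close>, so the update leaves the bijection
    \<open>e\<close> intact there.\<close>
  define e0 where "e0 = e(0 := mid)"
  define g where "g t = (case t of Left_End \<Rightarrow> x | Right_End \<Rightarrow> y
    | Inner i j \<Rightarrow> if j = 1 then e0 i else partner (e0 i))" for t
  have e_image: "e0 ` {1..k} = nb x - {mid}"
    using e by (auto simp: e0_def bij_betw_def)
  have e0_image: "e0 ` {..k} = nb x"
  proof -
    have "{..k} = insert 0 {1..k}" by auto
    then have "e0 ` {..k} = insert (e0 0) (e0 ` {1..k})" by simp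
    then show ?thesis
      using e_image mid(1) by (auto simp: e0_def)
  qed
  have ei: "e0 i \<in> nb x" "e0 i \<noteq> mid" if "i \<in> {1..k}" for i
    using e_image that by blast+
  have far_image: "(\<lambda>i. partner (e0 i)) ` {1..k} = far - {y}"
  proof -
    have "(\<lambda>i. partner (e0 i)) ` {1..k} = partner ` (nb x - {mid})"
      unfolding e_image[symmetric] image_image ..
    also have "\<dots> = partner ` nb x - partner ` {mid}"
      using partner_inj mid(1) by (intro inj_on_image_set_diff) auto
    finally show ?thesis
      using bij_partner mid(2) by (simp add: bij_betw_def)
  qed
  have V_split: "V = {x, y} \<union> nb x \<union> (far - {y})"
    using x_in y_in nbs_subset[of V E x] by (auto simp: far_def)
  have "g ` pverts (theta23 k) = {x, y} \<union> nb x \<union> (far - {y})"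
    unfolding theta23_verts image_Un image_image using e0_image far_image by (simp add: g_def)
  then have image: "g ` pverts (theta23 k) = V"
    by (rule trans[OF _ V_split[symmetric]])
  moreover have "inj_on g (pverts (theta23 k))"
  proof (rule eq_card_imp_inj_on)
    show fin: "finite (pverts (theta23 k))"
      by (simp add: theta23_verts)
    show "card (g ` pverts (theta23 k)) = card (pverts (theta23 k))"
      using card_theta23_verts[of k] card_image_le[OF fin, of g] card_V unfolding image by linarith
  qed
  ultimately have "bij_betw g (pverts (theta23 k)) V"
    by (simp add: bij_betw_def)
  moreover have "g ` (parcs (theta23 k) `` {t}) = nb (g t)" if t: "t \<in> pverts (theta23 k)" for t
  proof -
    consider "t = Left_End" | "t = Right_End" | "t = Inner 0 1"
      | i where "i \<in> {1..k}" "t = Inner i 1" | i where "i \<in> {1..k}" "t = Inner i 2"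
      using t unfolding theta23_verts by (force simp: Suc_le_eq)
    then show ?thesis
    proof cases
      case 1
      then show ?thesis
        using e0_image by (simp add: theta23_nbs image_image g_def)
    next
      case 2
      then show ?thesis
        using far_image unfolding 2 theta23_nbs by (simp add: image_image g_def nb_y(1)) (simp add: e0_def)
    next
      case 3
      then show ?thesis
        unfolding 3 theta23_nbs by (simp add: g_def e0_def near_nb(1)[OF mid(1)] mid(2))
    next
      case (4 i)
      then show ?thesis
        unfolding 4(2) theta23_nbs(4)[OF 4(1)] by (simp add: g_def near_nb(1)[OF ei(1)[OF 4(1)]])
    next
      case (5 i)
      then show ?thesis
        unfolding 5(2) theta23_nbs(5)[OF 5(1)] by (simp add: g_def nb_other(1)[OF ei[OF 5(1)]])
    qed
  qed
  ultimately show thesis by (rule that)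
qed

end

context pair_graph
begin

text \<open>Arc sets are unions of neighbourhoods, so a vertex bijection that matches neighbourhoods
  carries arcs onto arcs.\<close>

lemma iso_theta23_if_two_hubs:
  assumes "girth5_two_hubs (pverts G) (adj G) k x y"
  shows "digraph_iso (with_proj G) (with_proj (theta23 k))"
proof -
  interpret girth5_two_hubs "pverts G" "adj G" k x y by fact
  obtain g where g: "bij_betw g (pverts (theta23 k)) (pverts G)"
    and nb: "\<And>t. t \<in> pverts (theta23 k) \<Longrightarrow>
      g ` (parcs (theta23 k) `` {t}) = nbs (pverts G) (adj G) (g t)"
    using theta23_embedding by blast
  interpret T: pair_wf_digraph "theta23 k" by (rule pair_wf_theta23)
  have "parcs G = (\<Union>v\<in>pverts G. Pair v ` nbs (pverts G) (adj G) v)"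
    by (auto simp: nbs_def adj_def dest: in_arcsD1 in_arcsD2)
  also have "\<dots> = (\<Union>v\<in>g ` pverts (theta23 k). Pair v ` nbs (pverts G) (adj G) v)"
    using g by (simp add: bij_betw_def)
  also have "\<dots> = (\<Union>t\<in>pverts (theta23 k). Pair (g t) ` g ` (parcs (theta23 k) `` {t}))"
    using nb by simp
  also have "\<dots> = map_prod g g ` parcs (theta23 k)"
    by (force dest: T.in_arcsD1)
  finally have "digraph_iso (with_proj (theta23 k)) (with_proj G)"
    using g by (intro digraph_iso_image[of _ g] pair_wf_theta23) (auto simp: bij_betw_def)
  then show ?thesis
    by (rule digraph_iso_swap[OF T.wf_digraph_axioms])
qed

text \<open>An isomorphism preserves out-degrees, and both ends of the theta graph have degree
  \<open>k + 1\<close>.\<close>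

lemma two_hubs_if_iso_theta23:
  assumes "digraph_iso (with_proj G) (with_proj (theta23 k))"
  obtains x y where "x \<in> pverts G" "y \<in> pverts G" "x \<noteq> y"
    and "card (nbs (pverts G) (adj G) x) = k + 1" "card (nbs (pverts G) (adj G) y) = k + 1"
proof -
  interpret T: pair_wf_digraph "theta23 k" by (rule pair_wf_theta23)
  obtain f where f: "T.digraph_isomorphism f" and G: "with_proj G = app_iso f (with_proj (theta23 k))"
    using digraph_iso_swap[OF wf_digraph_axioms assms] by (auto simp: digraph_iso_def)
  have ends: "Left_End \<in> pverts (theta23 k)" "Right_End \<in> pverts (theta23 k)"
    by (auto simp: theta23_verts)
  let ?x = "iso_verts f Left_End" and ?y = "iso_verts f Right_End"
  have V: "pverts G = iso_verts f ` pverts (theta23 k)"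
    using arg_cong[OF G, of verts] by simp
  show thesis
  proof (rule that)
    show "?x \<in> pverts G" "?y \<in> pverts G"
      using ends by (auto simp: V)
    show "?x \<noteq> ?y"
      using T.iso_verts_eq_iff[OF f ends] by simp
    show "card (nbs (pverts G) (adj G) ?x) = k + 1" "card (nbs (pverts G) (adj G) ?y) = k + 1"
      using ends T.out_degree_app_iso_eq[OF f]
      by (simp_all add: G out_degree_theta23 flip: out_degree_eq_card_nbs)
  qed
qed

end

section \<open>Combination of the cases\<close>

theorem theorem3p1:
  fixes G :: "'a pair_pre_digraph" and k n :: nat
  assumes "k \<ge> 10"
    and "n = 2 * k + 3"
    and "pair_graph G"
    and "Digraph_Component.connected (with_proj G)"
    and "free_of {cycle_graph 3, cycle_graph 4} G"
    and "card (pverts G) = n"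
    and "\<not> has_pendant_vertex G"
  shows "q_index G \<le> q_prime n \<and>
         (q_index G = q_prime n \<longleftrightarrow>
            digraph_iso (with_proj G) (with_proj (theta_graph (2 # replicate ((n - 3) div 2) 3))))"
proof -
  interpret pair_graph G by fact
  interpret girth5 "pverts G" "adj G"
    using assms(5) by (rule girth5_if_free)
  let ?b = "real k + 2 + 2 / real k"
  have k: "10 \<le> k" and card: "card (pverts G) = 2 * k + 3"
    using assms by auto
  have ne: "pverts G \<noteq> {}"
    using card by auto
  have dg2: "2 \<le> dg v" if "v \<in> pverts G" for v
    using card that by (intro degree_ge_two assms) auto
  have hub: "girth5_hub (pverts G) (adj G) k x" if "x \<in> pverts G" "k + 1 \<le> dg x" for x
    using that k card dg2 by unfold_locales auto
  note root = q_prime_root[OF k]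
  have extremal: "q_index G = q_prime n \<and> digraph_iso (with_proj G) (with_proj (theta23 k))"
    if x: "x \<in> pverts G" "k + 1 \<le> dg x" and y: "y \<in> pverts G" "y \<noteq> x" "k + 1 \<le> dg y" for x y
  proof -
    interpret girth5_hub "pverts G" "adj G" k x
      using x by (rule hub)
    interpret girth5_two_hubs "pverts G" "adj G" k x y
      using y by unfold_locales
    have "0 \<le> 2 / real k" by simp
    then have q: "3 < q_prime n"
      using root(2) k unfolding assms(2) by linarith
    have "q_index G = q_prime n"
      using root(1) q
      by (intro q_index_eq[OF ne theta_weight_pos theta_weight_eigen])
        (auto simp: theta_cubic_def assms(2))
    moreover have "digraph_iso (with_proj G) (with_proj (theta23 k))"
      by (rule iso_theta23_if_two_hubs) unfold_locales
    ultimately show ?thesis ..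
  qed
  have strict: "q_index G < q_prime n"
    if few: "\<not> (\<exists>x\<in>pverts G. \<exists>y\<in>pverts G. y \<noteq> x \<and> k + 1 \<le> dg x \<and> k + 1 \<le> dg y)"
  proof -
    have "q_index G \<le> ?b"
    proof (cases "\<exists>x\<in>pverts G. k + 1 \<le> dg x")
      case True
      then obtain x where x: "x \<in> pverts G" "k + 1 \<le> dg x" by auto
      interpret girth5_hub "pverts G" "adj G" k x
        using x by (rule hub)
      have "dg v \<le> k" if "v \<in> pverts G" "v \<noteq> x" for v
      proof (rule ccontr)
        assume "\<not> dg v \<le> k"
        then have "k + 1 \<le> dg v" by simp
        with few x that show False by blast
      qed
      then show ?thesis
        by (intro q_index_le[OF ne hub_weight_pos hub_weight_supersolution])
    next
      case False
      then have "dg u \<le> k" if "u \<in> pverts G" for u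
        using that by (metis Suc_eq_plus1 not_less_eq_eq)
      then show ?thesis
        using card k dg2
        by (intro q_index_le[OF ne _ degree_supersolution]) (auto intro: less_le_trans[of 0 2])
    qed
    then show ?thesis
      using root(2) assms(2) by simp
  qed
  have "(n - 3) div 2 = k"
    using assms(2) by simp
  \<comment> \<open>These alternatives exclude each other, so the bound and both directions of the
    equality statement follow together.\<close>
  moreover have "q_index G < q_prime n \<and> \<not> digraph_iso (with_proj G) (with_proj (theta23 k)) \<or>
      q_index G = q_prime n \<and> digraph_iso (with_proj G) (with_proj (theta23 k))"
  proof (cases "\<exists>x\<in>pverts G. \<exists>y\<in>pverts G. y \<noteq> x \<and> k + 1 \<le> dg x \<and> k + 1 \<le> dg y")
    case True
    then show ?thesis using extremal by blast
  next
    case False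
    then have "\<not> digraph_iso (with_proj G) (with_proj (theta23 k))"
      by (metis order_refl two_hubs_if_iso_theta23)
    with strict[OF False] show ?thesis by simp
  qed
  ultimately show ?thesis by auto
qed

end
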